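(* Let $n\geq 1$, let $D\in\mathfrak{S}_n$ be a permutation of $[n]=\{1,\dots,n\}$, and let $E\subset[n]$ with $|E|>1$. Suppose that $D$ has either a cycle of length greater than one containing no element of $E$, or a cycle containing at least one element of $E$ and at least one element of $[n]\setminus E$. For a cyclic permutation $\gamma$ of $[n]$ (i.e. an $n$-cycle), let $c_E(D\circ\gamma)$ denote the number of cycles of $D\circ\gamma$ that contain no element of $E$, and let $\theta(D,E)=\max_{\gamma} c_E(D\circ\gamma)$, the maximum over all cyclic permutations $\gamma$ of $[n]$. Then $$\#\{\gamma \text{ cyclic}: c_E(D\circ\gamma)=\theta(D,E)-1\}\;\geq\;\tfrac12\,\#\{\gamma\text{ cyclic}: c_E(D\circ\gamma)=\theta(D,E)\}.$$ Moreover, the constant $1/2$ is best possible: there exist $n$, $D$ and $E$ satisfying the hypotheses for which equality holds.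
   Context: Permutations are composed right to left: $(D\circ\gamma)(x)=D(\gamma(x))$. A cycle of a permutation is said to be $E$-label free if it contains no element of $E$. *)

theory Defs
  imports Complex_Main "HOL-Combinatorics.Combinatorics"
begin

text \<open>Cycles are identified with their supports; fixed points in \<open>[n]\<close> count as cycles of length one.\<close>

definition perm_cycles :: "nat \<Rightarrow> (nat \<Rightarrow> nat) \<Rightarrow> nat set set" where
  "perm_cycles n p = orbit p ` {1..n}"

definition cyclic_perms :: "nat \<Rightarrow> (nat \<Rightarrow> nat) set" where
  "cyclic_perms n = {g. g permutes {1..n} \<and> cyclic_on g {1..n}}"

definition label_free_count :: "nat \<Rightarrow> nat set \<Rightarrow> (nat \<Rightarrow> nat) \<Rightarrow> nat" where
  "label_free_count n E p = card {C \<in> perm_cycles n p. C \<inter> E = {}}"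

definition theta :: "nat \<Rightarrow> (nat \<Rightarrow> nat) \<Rightarrow> nat set \<Rightarrow> nat" where
  "theta n D E = Max ((\<lambda>g. label_free_count n E (D \<circ> g)) ` cyclic_perms n)"

definition admissible :: "nat \<Rightarrow> (nat \<Rightarrow> nat) \<Rightarrow> nat set \<Rightarrow> bool" where
  "admissible n D E \<longleftrightarrow>
     n \<ge> 1 \<and> D permutes {1..n} \<and> E \<subseteq> {1..n} \<and> card E > 1 \<and>
     ((\<exists>C \<in> perm_cycles n D. card C > 1 \<and> C \<inter> E = {}) \<or>
      (\<exists>C \<in> perm_cycles n D. C \<inter> E \<noteq> {} \<and> C \<inter> ({1..n} - E) \<noteq> {}))"

end

theory Submission
  imports Defs
begin

text \<open>
  The count \<open>c\<^sub>E(D \<circ> \<gamma>)\<close> does not change when \<open>D\<close> is replaced by \<open>\<pi> \<circ> D\<close> with \<open>\<pi>\<close> a permutation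
  of \<open>E\<close>, so \<open>D\<close> may be taken with as many cycles as possible in this coset; then every cycle of
  \<open>D\<close> contains at most one element of \<open>E\<close>. Write \<open>\<sigma> = D \<circ> \<gamma>\<close>. The genus inequality
  \<open>c(D) + c(\<sigma>) \<le> n + 1\<close> gives \<open>\<theta> \<le> n - c(D)\<close>, and equality is attained when \<open>\<sigma>\<close> is a single cycle
  through one representative of every cycle of \<open>D\<close>, all elements of \<open>E\<close> among them. Hence \<open>\<gamma>\<close> is a
  maximizer iff equality holds in the genus inequality (the map with vertices the cycles of \<open>D\<close> and
  \<open>\<sigma>\<close> and edges the points of \<open>[n]\<close> is a plane tree) and \<open>E\<close> lies in one cycle of \<open>\<sigma>\<close>. In the tree
  case a cycle of \<open>D\<close> and a cycle of \<open>\<sigma>\<close> share at most one point.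

  Fix \<open>a \<noteq> b\<close> in \<open>E\<close> and a cycle \<open>C\<close> of \<open>D\<close> of length at least two. For a maximizer pick \<open>y\<close> in \<open>C\<close>
  outside the \<open>\<sigma>\<close>-cycle containing \<open>E\<close>. Replacing \<open>\<sigma>\<close> by \<open>(b y)(a b)\<sigma>\<close> cuts this cycle between
  \<open>a\<close> and \<open>b\<close> and glues the part of \<open>b\<close> to the cycle of \<open>y\<close>, which costs exactly one \<open>E\<close>-free cycle;
  either this move or the one with \<open>a\<close> and \<open>b\<close> exchanged keeps \<open>\<gamma>\<close> cyclic. Each of the two moves
  is injective, because \<open>y\<close> is recovered as the only common point of \<open>C\<close> and the new cycle through
  \<open>b\<close> (respectively \<open>a\<close>). Hence the maximizers are at most twice as many as the next level.
\<close>

subsection \<open>Orbits under left multiplication\<close>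

lemma orbit_subsetI:
  assumes "a \<in> A" "\<And>z. z \<in> A \<Longrightarrow> f z \<in> A"
  shows "orbit f a \<subseteq> A"
proof
  fix y assume "y \<in> orbit f a"
  then show "y \<in> A" by induct (auto simp: assms)
qed

lemma orbit_eq_iff:
  assumes "permutation p"
  shows "orbit p a = orbit p b \<longleftrightarrow> a \<in> orbit p b"
  using cyclic_on_orbit'[OF assms] permutation_self_in_orbit[OF assms]
  by (metis orbit_cyclic_eq3)

lemma orbit_disjoint:
  assumes "permutation p" "b \<notin> orbit p a"
  shows "orbit p a \<inter> orbit p b = {}"
proof (rule ccontr)
  assume "orbit p a \<inter> orbit p b \<noteq> {}"
  then obtain z where "z \<in> orbit p a" "z \<in> orbit p b" by blast
  then have "orbit p a = orbit p b" using orbit_eq_iff[OF assms(1)] by metis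
  then show False using assms(2) permutation_self_in_orbit[OF assms(1), of b] by simp
qed

lemma orbit_permutes_comp_disjoint:
  assumes "\<pi> permutes E" "permutation p" "orbit p z \<inter> E = {}"
  shows "orbit (\<pi> \<circ> p) z = orbit p z"
proof (rule orbit_cong)
  show "z \<in> orbit p z" using assms(2) by (rule permutation_self_in_orbit)
  fix s assume "s \<in> orbit p z"
  then have "p s \<in> orbit p z" by (rule orbit.step)
  then show "(\<pi> \<circ> p) s = p s" using assms(3) permutes_not_in[OF assms(1)] by auto
qed

text \<open>Starting at \<open>t\<close>, the map \<open>\<pi> \<circ> p\<close> follows the \<open>p\<close>-orbit of \<open>t\<close>, which contains no other
  point of \<open>T\<close>, until it would return to \<open>t\<close>, and then jumps to \<open>\<pi> t\<close>.\<close>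

lemma orbit_subset_orbit_permutes_comp:
  assumes p: "permutation p" and inj: "inj_on (orbit p) T"
    and \<pi>: "\<pi> permutes T" and t: "t \<in> T"
  shows "orbit \<pi> t \<subseteq> orbit (\<pi> \<circ> p) t"
proof
  have jump: "\<pi> u \<in> orbit (\<pi> \<circ> p) u" if u: "u \<in> T" for u
  proof -
    have advance: "\<pi> (p z) \<in> orbit (\<pi> \<circ> p) u" if "z \<in> insert u (orbit (\<pi> \<circ> p) u)" for z
      using that orbit.base[of "\<pi> \<circ> p" u] orbit.step[of z "\<pi> \<circ> p" u] by auto
    have follow: "orbit p u \<subseteq> insert u (orbit (\<pi> \<circ> p) u) \<inter> orbit p u"
    proof (rule orbit_subsetI)
      fix z assume z: "z \<in> insert u (orbit (\<pi> \<circ> p) u) \<inter> orbit p u"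
      then have pz: "p z \<in> orbit p u" by (blast intro: orbit.step)
      have "p z = u" if "p z \<in> T"
        using inj_onD[OF inj _ that u] pz orbit_eq_iff[OF p] by blast
      then show "p z \<in> insert u (orbit (\<pi> \<circ> p) u) \<inter> orbit p u"
        using pz z advance[of z] permutes_not_in[OF \<pi>, of "p z"] by (cases "p z \<in> T") auto
    qed (simp add: permutation_self_in_orbit[OF p])
    have "inv p u \<in> orbit p u"
      using orbit_inv_eq[OF p, of u] orbit.base[of "inv p" u] by simp
    then have "\<pi> (p (inv p u)) \<in> orbit (\<pi> \<circ> p) u" using follow advance by blast
    then show ?thesis using bij_is_surj[OF permutation_bijective[OF p]] by (simp add: surj_f_inv_f)
  qed
  fix y assume "y \<in> orbit \<pi> t"
  then have "y \<in> T \<and> y \<in> orbit (\<pi> \<circ> p) t"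
  proof induct
    case base
    show ?case using jump[OF t] t permutes_in_image[OF \<pi>] by blast
  next
    case (step y)
    then show ?case using jump permutes_in_image[OF \<pi>] orbit_trans by fast
  qed
  then show "y \<in> orbit (\<pi> \<circ> p) t" ..
qed

lemma permutation_transpose_comp [simp]:
  "permutation (transpose a b \<circ> p) \<longleftrightarrow> permutation p"
proof
  assume "permutation (transpose a b \<circ> p)"
  then have "permutation (transpose a b \<circ> (transpose a b \<circ> p))"
    by (rule permutation_compose[OF permutation_swap_id])
  then show "permutation p" by (simp add: comp_assoc[symmetric])
qed (intro permutation_compose permutation_swap_id)

lemma permutes_transpose_comp:
  "p permutes S \<Longrightarrow> a \<in> S \<Longrightarrow> b \<in> S \<Longrightarrow> transpose a b \<circ> p permutes S"
  by (intro permutes_compose permutes_swap_id)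

lemma orbit_transpose_comp_Un:
  assumes p: "permutation p"
  shows "orbit (transpose a b \<circ> p) a \<union> orbit (transpose a b \<circ> p) b = orbit p a \<union> orbit p b"
proof -
  have sub: "orbit (transpose a b \<circ> q) c \<subseteq> orbit q a \<union> orbit q b"
    if q: "permutation q" and c: "c = a \<or> c = b" for q c
  proof (rule orbit_subsetI)
    show "c \<in> orbit q a \<union> orbit q b" using c permutation_self_in_orbit[OF q] by blast
    fix z assume "z \<in> orbit q a \<union> orbit q b"
    then have "q z \<in> orbit q a \<union> orbit q b" by (blast intro: orbit.step)
    then show "(transpose a b \<circ> q) z \<in> orbit q a \<union> orbit q b"
      using permutation_self_in_orbit[OF q] by (auto simp: transpose_def)
  qed
  have "transpose a b \<circ> (transpose a b \<circ> p) = p" by (simp add: comp_assoc[symmetric])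
  then show ?thesis using sub[of p] sub[of "transpose a b \<circ> p"] p by auto
qed

lemma notin_orbit_transpose_comp:
  assumes b: "b \<in> orbit p a" and ab: "a \<noteq> b"
  shows "b \<notin> orbit (transpose a b \<circ> p) a"
proof -
  let ?N = "funpow_dist p a b"
  let ?segment = "(\<lambda>i. (p ^^ i) a) ` {..<?N}"
  have a: "a \<in> ?segment" using ab funpow_dist_0_eq[OF b] by (auto intro: image_eqI[of _ _ 0])
  have "orbit (transpose a b \<circ> p) a \<subseteq> ?segment"
  proof (rule orbit_subsetI[OF a])
    fix z assume "z \<in> ?segment"
    then obtain i where i: "i < ?N" "z = (p ^^ i) a" by blast
    show "(transpose a b \<circ> p) z \<in> ?segment"
    proof (cases "Suc i = ?N")
      case True
      then have "p z = b" using i(2) funpow_dist_prop[OF b] by (simp flip: True)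
      then show ?thesis using a by simp
    next
      case False
      then have "(p ^^ Suc i) a \<noteq> (p ^^ 0) a" "(p ^^ Suc i) a \<noteq> b"
        using i(1) funpow_neq_less_funpow_dist[OF b, of "Suc i" 0]
          funpow_dist_least[of "Suc i" p a b] by auto
      then have "(transpose a b \<circ> p) z = (p ^^ Suc i) a" using i(2) by simp
      then show ?thesis using i(1) False by (intro image_eqI[of _ _ "Suc i"]) auto
    qed
  qed
  then show ?thesis using funpow_dist_least by fastforce
qed

lemma in_orbit_transpose_comp_iff:
  assumes p: "permutation p" and ab: "a \<noteq> b"
  shows "b \<in> orbit (transpose a b \<circ> p) a \<longleftrightarrow> b \<notin> orbit p a"
proof
  assume "b \<notin> orbit p a"
  then have "orbit p a \<noteq> orbit p b" using permutation_self_in_orbit[OF p, of b] by blast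
  then have "inj_on (orbit p) {a, b}" by auto
  then have "orbit (transpose a b) a \<subseteq> orbit (transpose a b \<circ> p) a"
    using p by (intro orbit_subset_orbit_permutes_comp[where T = "{a, b}"] permutes_swap_id) auto
  then show "b \<in> orbit (transpose a b \<circ> p) a" using orbit.base[of "transpose a b" a] by auto
qed (use notin_orbit_transpose_comp[OF _ ab, of p] in blast)

subsection \<open>Counting cycles\<close>

definition cycles_on :: "'a set \<Rightarrow> ('a \<Rightarrow> 'a) \<Rightarrow> 'a set set" where
  "cycles_on S p = orbit p ` S"

definition free_cycles_on :: "'a set \<Rightarrow> 'a set \<Rightarrow> ('a \<Rightarrow> 'a) \<Rightarrow> 'a set set" where
  "free_cycles_on S E p = {C \<in> cycles_on S p. C \<inter> E = {}}"

definition cyclic_perms_on :: "'a set \<Rightarrow> ('a \<Rightarrow> 'a) set" where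
  "cyclic_perms_on S = {g. g permutes S \<and> cyclic_on g S}"

lemma finite_cycles_on [simp]: "finite S \<Longrightarrow> finite (cycles_on S p)"
  by (simp add: cycles_on_def)

lemma finite_free_cycles_on [simp]: "finite S \<Longrightarrow> finite (free_cycles_on S E p)"
  by (simp add: free_cycles_on_def)

lemma finite_cyclic_perms_on [simp]: "finite S \<Longrightarrow> finite (cyclic_perms_on S)"
  by (rule finite_subset[of _ "{g. g permutes S}"])
    (auto simp: cyclic_perms_on_def finite_permutations)

lemma card_cycles_on_le: "finite S \<Longrightarrow> card (cycles_on S p) \<le> card S"
  by (simp add: cycles_on_def card_image_le)

lemma card_cycles_on_id: "card (cycles_on S id) = card S"
proof -
  have "orbit id z = {z}" for z :: 'a by (simp add: orbit_eq_singleton_iff)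
  then show ?thesis by (simp add: cycles_on_def card_image)
qed

lemma cycles_on_inv: "permutation p \<Longrightarrow> cycles_on S (inv p) = cycles_on S p"
  by (simp add: cycles_on_def orbit_inv_eq)

lemma free_cycles_on_permutes_comp:
  assumes p: "permutation p" and \<pi>: "\<pi> permutes E" "permutation \<pi>"
  shows "free_cycles_on S E (\<pi> \<circ> p) = free_cycles_on S E p"
proof -
  have sub: "free_cycles_on S E q \<subseteq> free_cycles_on S E (\<rho> \<circ> q)"
    if "permutation q" "\<rho> permutes E" for q \<rho>
    using orbit_permutes_comp_disjoint[OF that(2,1)]
    by (auto simp: free_cycles_on_def cycles_on_def image_iff)
  have "inv \<pi> \<circ> (\<pi> \<circ> p) = p" by (simp add: comp_assoc[symmetric] permutes_inv_o[OF \<pi>(1)])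
  then show ?thesis
    using sub[OF p \<pi>(1)] sub[OF permutation_compose[OF \<pi>(2) p] permutes_inv[OF \<pi>(1)]] by auto
qed

lemma orbit_eq_cycle_iff:
  assumes "permutation p" "C \<in> cycles_on S p"
  shows "orbit p u = C \<longleftrightarrow> u \<in> C"
proof -
  obtain z where "C = orbit p z" using assms(2) by (auto simp: cycles_on_def)
  then show ?thesis using orbit_eq_iff[OF assms(1), of u z] by simp
qed

lemma free_cycles_on_insert:
  assumes "permutation p"
  shows "free_cycles_on S (insert y E) p = free_cycles_on S E p - {orbit p y}"
proof (rule set_eqI)
  fix C
  show "C \<in> free_cycles_on S (insert y E) p \<longleftrightarrow> C \<in> free_cycles_on S E p - {orbit p y}"
    using orbit_eq_cycle_iff[OF assms, of C S y] unfolding free_cycles_on_def by auto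
qed

lemma card_cycles_on_eq_free:
  assumes S: "finite S" and p: "permutation p" and E: "E \<subseteq> S"
  shows "card (cycles_on S p) = card (free_cycles_on S E p) + card (orbit p ` E)"
proof -
  have meets: "C \<in> orbit p ` E \<longleftrightarrow> C \<inter> E \<noteq> {}" if "C \<in> cycles_on S p" for C
    using orbit_eq_cycle_iff[OF p that] by blast
  have "orbit p ` E \<subseteq> cycles_on S p" using E by (auto simp: cycles_on_def)
  then have "cycles_on S p = free_cycles_on S E p \<union> orbit p ` E"
    and "free_cycles_on S E p \<inter> orbit p ` E = {}"
    using meets by (auto simp: free_cycles_on_def)
  then show ?thesis using S finite_subset[OF E S] by (simp add: card_Un_disjoint)
qed

lemma card_free_cycles_on_less:
  assumes S: "finite S" and p: "permutation p" and E: "E \<subseteq> S" "E \<noteq> {}"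
  shows "card (free_cycles_on S E p) < card (cycles_on S p)"
proof -
  have "card (orbit p ` E) > 0" using E(2) finite_subset[OF E(1) S] by (simp add: card_gt_0_iff)
  then show ?thesis using card_cycles_on_eq_free[OF S p E(1)] by simp
qed

lemma card_free_cycles_on_eq_iff:
  assumes S: "finite S" and p: "permutation p" and E: "E \<subseteq> S" "e \<in> E"
  shows "card (free_cycles_on S E p) + 1 = card (cycles_on S p) \<longleftrightarrow> E \<subseteq> orbit p e"
proof -
  have "card (free_cycles_on S E p) + 1 = card (cycles_on S p) \<longleftrightarrow> card (orbit p ` E) = 1"
    using card_cycles_on_eq_free[OF S p E(1)] by auto
  also have "\<dots> \<longleftrightarrow> orbit p ` E \<subseteq> {orbit p e}"
  proof
    assume "card (orbit p ` E) = 1"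
    then obtain C where "orbit p ` E = {C}" by (rule card_1_singletonE)
    then show "orbit p ` E \<subseteq> {orbit p e}" using imageI[OF E(2), of "orbit p"] by simp
  next
    assume "orbit p ` E \<subseteq> {orbit p e}"
    then have "orbit p ` E = {orbit p e}"
      using imageI[OF E(2), of "orbit p"] by (intro equalityI) simp_all
    then show "card (orbit p ` E) = 1" by simp
  qed
  also have "\<dots> \<longleftrightarrow> E \<subseteq> orbit p e" by (simp add: image_subset_iff orbit_eq_iff[OF p] subset_eq)
  finally show ?thesis .
qed

lemma card_cycles_on_merge:
  assumes S: "finite S" and p: "permutation p"
    and ab: "a \<in> S" "b \<in> S" "b \<notin> orbit p a"
  shows "card (cycles_on S p) = card (cycles_on S (transpose a b \<circ> p)) + 1"
proof -
  let ?q = "transpose a b \<circ> p"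
  have q: "permutation ?q" using p by simp
  have ne: "a \<noteq> b" using ab(3) permutation_self_in_orbit[OF p] by blast
  have free: "free_cycles_on S {a, b} ?q = free_cycles_on S {a, b} p"
    using p by (intro free_cycles_on_permutes_comp permutes_swap_id permutation_swap_id) auto
  have "orbit p a \<noteq> orbit p b" using ab(3) permutation_self_in_orbit[OF p, of b] by blast
  then have "card (orbit p ` {a, b}) = 2" by simp
  moreover have "orbit ?q b = orbit ?q a"
    using in_orbit_transpose_comp_iff[OF p ne] ab(3) orbit_eq_iff[OF q] by blast
  then have "card (orbit ?q ` {a, b}) = 1" by simp
  ultimately show ?thesis
    using card_cycles_on_eq_free[OF S p, of "{a, b}"] card_cycles_on_eq_free[OF S q, of "{a, b}"]
      free ab by simp
qed

lemma card_cycles_on_split: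
  assumes S: "finite S" and p: "permutation p"
    and ab: "a \<in> S" "b \<in> S" "b \<in> orbit p a" "a \<noteq> b"
  shows "card (cycles_on S (transpose a b \<circ> p)) = card (cycles_on S p) + 1"
proof -
  have "b \<notin> orbit (transpose a b \<circ> p) a" using ab(3,4) by (rule notin_orbit_transpose_comp)
  then have "card (cycles_on S (transpose a b \<circ> p))
      = card (cycles_on S (transpose a b \<circ> (transpose a b \<circ> p))) + 1"
    using S p ab by (intro card_cycles_on_merge) auto
  then show ?thesis by (simp add: comp_assoc[symmetric])
qed

lemma cyclic_perms_on_imp_permutation: "finite S \<Longrightarrow> g \<in> cyclic_perms_on S \<Longrightarrow> permutation g"
  unfolding cyclic_perms_on_def using permutes_imp_permutation by blast

lemma cyclic_perms_on_iff_card: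
  assumes "finite S"
  shows "g \<in> cyclic_perms_on S \<longleftrightarrow> g permutes S \<and> card (cycles_on S g) = 1"
proof -
  have "cyclic_on g S \<longleftrightarrow> card (cycles_on S g) = 1" if g: "g permutes S"
  proof
    assume "cyclic_on g S"
    then have "cycles_on S g = {S}" by (auto simp: cycles_on_def cyclic_on_alldef)
    then show "card (cycles_on S g) = 1" by simp
  next
    assume "card (cycles_on S g) = 1"
    then obtain C where C: "cycles_on S g = {C}" by (rule card_1_singletonE)
    then have "C \<in> orbit g ` S" by (simp add: cycles_on_def)
    then obtain z where z: "z \<in> S" "C = orbit g z" by blast
    have "orbit g u = C" if "u \<in> S" for u using C that by (auto simp: cycles_on_def)
    then have "S \<subseteq> C"
      using permutation_self_in_orbit[OF permutes_imp_permutation[OF assms g]] by blast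
    moreover have "C \<subseteq> S" using permutes_orbit_subset[OF g z(1)] z(2) by simp
    ultimately have "S = orbit g z" using z(2) by simp
    with z(1) show "cyclic_on g S" by (rule cyclic_on_singleI)
  qed
  then show ?thesis by (auto simp: cyclic_perms_on_def)
qed

subsection \<open>The genus inequality\<close>

lemma card_cycles_on_transpose_comp_le:
  assumes "finite S" "permutation p" "a \<in> S" "b \<in> S"
  shows "card (cycles_on S (transpose a b \<circ> p)) \<le> card (cycles_on S p) + 1"
proof (cases "b \<in> orbit p a \<and> a \<noteq> b")
  case True
  then show ?thesis using card_cycles_on_split[OF assms] by simp
next
  case False
  then show ?thesis using card_cycles_on_merge[OF assms] by (cases "a = b") auto
qed

lemma card_cycles_on_comp_le:
  assumes S: "finite S" and "p permutes S" and q: "permutation q"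
  shows "card (cycles_on S p) + card (cycles_on S (p \<circ> q)) \<le> card S + card (cycles_on S q)"
  using assms(2)
proof (induction "card S - card (cycles_on S p)" arbitrary: p rule: less_induct)
  case less
  show ?case
  proof (cases "p = id")
    case True
    then show ?thesis using card_cycles_on_le[OF S] by simp
  next
    case False
    then obtain a where moved: "p a \<noteq> a" by (auto simp: fun_eq_iff)
    then have in_S: "a \<in> S" "p a \<in> S"
      using permutes_not_in[OF less.prems] permutes_in_image[OF less.prems] by auto
    have perm: "permutation p" using S less.prems by (rule permutes_imp_permutation)
    let ?r = "transpose a (p a) \<circ> p"
    have more: "card (cycles_on S ?r) = card (cycles_on S p) + 1"
      using card_cycles_on_split[OF S perm in_S orbit.base] moved by simp
    have "card (cycles_on S ?r) + card (cycles_on S (?r \<circ> q)) \<le> card S + card (cycles_on S q)"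
      using more card_cycles_on_le[OF S, of ?r] permutes_transpose_comp[OF less.prems in_S]
      by (intro less.hyps) auto
    moreover have "card (cycles_on S (p \<circ> q)) \<le> card (cycles_on S (?r \<circ> q)) + 1"
      using card_cycles_on_transpose_comp_le[OF S _ in_S, of "?r \<circ> q"]
        permutation_compose[OF _ q] perm by (simp flip: comp_assoc)
    ultimately show ?thesis using more by linarith
  qed
qed

lemma orbits_meet_once:
  assumes S: "finite S" and p: "p permutes S" and q: "permutation q"
    and eq: "card (cycles_on S p) + card (cycles_on S (p \<circ> q)) = card S + card (cycles_on S q)"
    and x: "x \<in> S" and y: "y \<in> orbit p x" "y \<in> orbit (p \<circ> q) x"
  shows "x = y"
proof (rule ccontr)
  assume ne: "x \<noteq> y"
  have y_in_S: "y \<in> S" using permutes_orbit_subset[OF p x] y(1) by blast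
  have perm_p: "permutation p" using S p by (rule permutes_imp_permutation)
  have "card (cycles_on S (transpose x y \<circ> p)) = card (cycles_on S p) + 1"
    using S perm_p x y_in_S y(1) ne by (rule card_cycles_on_split)
  moreover have "card (cycles_on S (transpose x y \<circ> (p \<circ> q))) = card (cycles_on S (p \<circ> q)) + 1"
    using S permutation_compose[OF perm_p q] x y_in_S y(2) ne by (rule card_cycles_on_split)
  moreover have "card (cycles_on S (transpose x y \<circ> p)) +
      card (cycles_on S ((transpose x y \<circ> p) \<circ> q)) \<le> card S + card (cycles_on S q)"
    using S permutes_transpose_comp[OF p x y_in_S] q by (rule card_cycles_on_comp_le)
  ultimately show False using eq by (simp add: comp_assoc)
qed

subsection \<open>Cycles through a transversal\<close>

lemma funpow_cycle_of_list_hd: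
  assumes "distinct cs" "i < length cs"
  shows "(cycle_of_list cs ^^ i) (hd cs) = cs ! i"
proof -
  have "hd (map (cycle_of_list cs ^^ i) cs) = hd (rotate i cs)"
    using cyclic_rotation[OF assms(1)] by simp
  then show ?thesis
    using assms(2) by (cases cs) (auto simp: hd_rotate_conv_nth simp del: rotate_Suc)
qed

lemma cycle_of_list_in_cyclic_perms_on:
  assumes "distinct cs" "cs \<noteq> []"
  shows "cycle_of_list cs \<in> cyclic_perms_on (set cs)"
proof -
  have hd: "hd cs \<in> set cs" using assms(2) by simp
  have "set cs \<subseteq> orbit (cycle_of_list cs) (hd cs)"
  proof
    fix x assume "x \<in> set cs"
    then obtain i where "i < length cs" "x = cs ! i" by (auto simp: in_set_conv_nth)
    then have "x = (cycle_of_list cs ^^ i) (hd cs)"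
      using funpow_cycle_of_list_hd[OF assms(1)] by simp
    then show "x \<in> orbit (cycle_of_list cs) (hd cs)"
      by (auto simp: orbit_altdef_permutation[OF permutation_of_cycle])
  qed
  then have "set cs = orbit (cycle_of_list cs) (hd cs)"
    using permutes_orbit_subset[OF cycle_permutes hd] by blast
  with hd have "cyclic_on (cycle_of_list cs) (set cs)" by (rule cyclic_on_singleI)
  then show ?thesis by (simp add: cyclic_perms_on_def cycle_permutes)
qed

lemma cyclic_perms_on_nonempty:
  assumes "finite S" "S \<noteq> {}"
  shows "cyclic_perms_on S \<noteq> {}"
proof -
  obtain cs where "distinct cs" "set cs = S" using finite_distinct_list[OF assms(1)] by blast
  then show ?thesis using cycle_of_list_in_cyclic_perms_on[of cs] assms(2) by auto
qed

lemma card_cycles_on_cyclic_subset: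
  assumes S: "finite S" and T: "T \<subseteq> S" and \<tau>: "\<tau> \<in> cyclic_perms_on T"
  shows "card (cycles_on S \<tau>) + card T = card S + 1"
proof -
  have \<tau>T: "\<tau> permutes T" using \<tau> by (simp add: cyclic_perms_on_def)
  have perm: "permutation \<tau>"
    using finite_subset[OF T S] \<tau> by (rule cyclic_perms_on_imp_permutation)
  have id: "permutation (id :: 'a \<Rightarrow> 'a)" by (rule permutation_id)
  have "card (orbit \<tau> ` T) = 1"
    using \<tau> cyclic_perms_on_iff_card[OF finite_subset[OF T S]] by (simp add: cycles_on_def)
  then have "card (cycles_on S \<tau>) = card (free_cycles_on S T \<tau>) + 1"
    using card_cycles_on_eq_free[OF S perm T] by simp
  moreover have "free_cycles_on S T \<tau> = free_cycles_on S T id"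
    using free_cycles_on_permutes_comp[OF id \<tau>T perm] by simp
  moreover have "card S = card (free_cycles_on S T id) + card T"
    using card_cycles_on_eq_free[OF S id T] card_cycles_on_id[of S] card_cycles_on_id[of T]
    by (simp add: cycles_on_def)
  ultimately show ?thesis by simp
qed

lemma cyclic_perms_on_comp_transversal:
  assumes S: "finite S" and p: "p permutes S" and T: "T \<subseteq> S" "inj_on (orbit p) T"
    "orbit p ` T = cycles_on S p" and \<tau>: "\<tau> \<in> cyclic_perms_on T"
  shows "\<tau> \<circ> p \<in> cyclic_perms_on S"
proof -
  have \<tau>T: "\<tau> permutes T" and cyc: "cyclic_on \<tau> T" using \<tau> by (auto simp: cyclic_perms_on_def)
  have perm_p: "permutation p" using S p by (rule permutes_imp_permutation)
  have perm_\<tau>: "permutation \<tau>"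
    using finite_subset[OF T(1) S] \<tau> by (rule cyclic_perms_on_imp_permutation)
  have perm: "permutation (\<tau> \<circ> p)" using perm_\<tau> perm_p by (rule permutation_compose)
  have "card (free_cycles_on S T (\<tau> \<circ> p)) = 0"
    using free_cycles_on_permutes_comp[OF perm_p \<tau>T perm_\<tau>]
      card_cycles_on_eq_free[OF S perm_p T(1)] T(3) by simp
  then have "card (cycles_on S (\<tau> \<circ> p)) = card (orbit (\<tau> \<circ> p) ` T)"
    using card_cycles_on_eq_free[OF S perm T(1)] by simp
  also have "\<dots> = 1"
  proof -
    obtain t where t: "t \<in> T" "T = orbit \<tau> t" using cyc by (auto simp: cyclic_on_def)
    then have "T \<subseteq> orbit (\<tau> \<circ> p) t"
      using orbit_subset_orbit_permutes_comp[OF perm_p T(2) \<tau>T t(1)] by simp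
    then have "orbit (\<tau> \<circ> p) ` T = {orbit (\<tau> \<circ> p) t}"
      using t(1) orbit_eq_iff[OF perm, of _ t] by auto
    then show ?thesis by simp
  qed
  finally show ?thesis
    using cyclic_perms_on_iff_card[OF S] permutes_compose[OF p permutes_subset[OF \<tau>T T(1)]] by simp
qed

lemma inv_cyclic_perms_on:
  assumes "finite S" "g \<in> cyclic_perms_on S"
  shows "inv g \<in> cyclic_perms_on S"
proof -
  have "g permutes S" "card (cycles_on S g) = 1" using assms cyclic_perms_on_iff_card by auto
  moreover have "cycles_on S (inv g) = cycles_on S g"
    using cyclic_perms_on_imp_permutation[OF assms] by (rule cycles_on_inv)
  ultimately show ?thesis using assms(1) by (simp add: cyclic_perms_on_iff_card permutes_inv)
qed

lemma inj_on_extend_same_image: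
  assumes "inj_on f E" "E \<subseteq> S"
  obtains T where "E \<subseteq> T" "T \<subseteq> S" "inj_on f T" "f ` T = f ` S"
proof -
  have "f ` S - f ` E \<subseteq> f ` S" by blast
  then obtain U where U: "U \<subseteq> S" "inj_on f U" "f ` S - f ` E = f ` U"
    using subset_image_inj[of "f ` S - f ` E" f S] by blast
  show thesis
  proof
    show "inj_on f (E \<union> U)" using assms(1) U(2,3) by (auto simp: inj_on_Un)
    show "f ` (E \<union> U) = f ` S" using assms(2) U(3) by auto
  qed (use assms(2) U(1) in auto)
qed

lemma exists_genus_zero_cyclic_perm:
  assumes S: "finite S" and D: "D permutes S" and E: "E \<subseteq> S" "inj_on (orbit D) E" "e \<in> E"
  obtains g where "g \<in> cyclic_perms_on S"
    "card (cycles_on S D) + card (cycles_on S (D \<circ> g)) = card S + 1" "E \<subseteq> orbit (D \<circ> g) e"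
proof -
  obtain T where T: "E \<subseteq> T" "T \<subseteq> S" "inj_on (orbit D) T" "orbit D ` T = orbit D ` S"
    using inj_on_extend_same_image[OF E(2,1)] .
  have finT: "finite T" using T(2) S by (rule finite_subset)
  obtain \<tau> where \<tau>: "\<tau> \<in> cyclic_perms_on T"
    using cyclic_perms_on_nonempty[OF finT] T(1) E(3) by blast
  define \<sigma> where "\<sigma> = inv \<tau>"
  have \<sigma>: "\<sigma> \<in> cyclic_perms_on T" unfolding \<sigma>_def using finT \<tau> by (rule inv_cyclic_perms_on)
  have bij: "bij D" "bij \<tau>"
    using D \<tau> by (auto simp: cyclic_perms_on_def intro: permutes_bij)
  show thesis
  proof
    have "\<tau> \<circ> D \<in> cyclic_perms_on S"
      using T(4)
      by (intro cyclic_perms_on_comp_transversal[OF S D T(2,3) _ \<tau>]) (simp add: cycles_on_def)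
    then have "inv (\<tau> \<circ> D) \<in> cyclic_perms_on S" by (rule inv_cyclic_perms_on[OF S])
    then show "inv D \<circ> \<sigma> \<in> cyclic_perms_on S"
      using o_inv_distrib[OF bij(2,1)] by (simp add: \<sigma>_def)
    have eq: "D \<circ> (inv D \<circ> \<sigma>) = \<sigma>"
      using permutes_inv_o(1)[OF D] by (simp add: comp_assoc[symmetric])
    have "card (cycles_on S D) = card T" using card_image[OF T(3)] T(4) by (simp add: cycles_on_def)
    then show "card (cycles_on S D) + card (cycles_on S (D \<circ> (inv D \<circ> \<sigma>))) = card S + 1"
      unfolding eq using card_cycles_on_cyclic_subset[OF S T(2) \<sigma>] by simp
    have "orbit \<sigma> e = T" using \<sigma> T(1) E(3) by (auto simp: cyclic_perms_on_def cyclic_on_alldef)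
    then show "E \<subseteq> orbit (D \<circ> (inv D \<circ> \<sigma>)) e" unfolding eq using T(1) by simp
  qed
qed

subsection \<open>Cutting a cycle and gluing the part to another\<close>

lemma card_free_cycles_on_glue:
  assumes S: "finite S" and p: "permutation p" and b: "b \<in> E"
    and y: "y \<in> S" "orbit p y \<inter> E = {}"
  shows "card (free_cycles_on S E (transpose b y \<circ> p)) + 1 = card (free_cycles_on S E p)"
proof -
  let ?q = "transpose b y \<circ> p"
  have q: "permutation ?q" using p by simp
  have yb: "y \<notin> orbit p b" "b \<noteq> y"
    using y(2) b orbit_eq_iff[OF p, of y b] permutation_self_in_orbit[OF p] by blast+
  have "b \<in> orbit ?q y"
    using in_orbit_transpose_comp_iff[OF p yb(2)] yb(1) orbit_eq_iff[OF q, of y b]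
      permutation_self_in_orbit[OF q, of b] by simp
  then have "orbit ?q y \<notin> free_cycles_on S E ?q" using b by (auto simp: free_cycles_on_def)
  then have "free_cycles_on S E ?q = free_cycles_on S (insert y E) ?q"
    using free_cycles_on_insert[OF q] by auto
  also have "\<dots> = free_cycles_on S (insert y E) p"
    using p b by (intro free_cycles_on_permutes_comp permutes_swap_id permutation_swap_id) auto
  also have "\<dots> = free_cycles_on S E p - {orbit p y}" using p by (rule free_cycles_on_insert)
  finally have "free_cycles_on S E ?q = free_cycles_on S E p - {orbit p y}" .
  moreover have "orbit p y \<in> free_cycles_on S E p"
    using y by (simp add: free_cycles_on_def cycles_on_def)
  ultimately show ?thesis using S card_Suc_Diff1[of "free_cycles_on S E p" "orbit p y"] by simp
qed

lemma cycles_on_cut_and_glue: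
  assumes S: "finite S" and p: "permutation p" and ab: "a \<in> E" "b \<in> E" "a \<noteq> b"
    and E: "E \<subseteq> S" "E \<subseteq> orbit p a" and y: "y \<in> S" "y \<notin> orbit p a"
    and q: "q = transpose b y \<circ> (transpose a b \<circ> p)"
  shows "card (free_cycles_on S E q) + 1 = card (free_cycles_on S E p)"
    and "card (cycles_on S q) = card (cycles_on S p)"
    and "y \<in> orbit q b"
proof -
  define h where "h = transpose a b \<circ> p"
  have h: "permutation h" using p by (simp add: h_def)
  have b: "b \<in> orbit p a" using E(2) ab(2) by blast
  have "orbit h a \<union> orbit h b = orbit p a"
    using orbit_transpose_comp_Un[OF p, of a b] orbit_eq_iff[OF p, of b a] b by (simp add: h_def)
  then have y_h: "y \<notin> orbit h a" "y \<notin> orbit h b" and E_h: "E \<subseteq> orbit h a \<union> orbit h b"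
    using y(2) E(2) by auto
  have "orbit h y \<inter> E = {}"
    using E_h orbit_disjoint[OF h y_h(1)] orbit_disjoint[OF h y_h(2)] by blast
  then have "card (free_cycles_on S E q) + 1 = card (free_cycles_on S E h)"
    unfolding q h_def[symmetric] using S h ab(2) y(1)
    by (intro card_free_cycles_on_glue)
  also have "free_cycles_on S E h = free_cycles_on S E p"
    unfolding h_def using p ab
    by (intro free_cycles_on_permutes_comp permutes_swap_id permutation_swap_id)
  finally show "card (free_cycles_on S E q) + 1 = card (free_cycles_on S E p)" .
  have "a \<in> S" "b \<in> S" using ab E(1) by auto
  then show "card (cycles_on S q) = card (cycles_on S p)"
    using card_cycles_on_split[OF S p _ _ b ab(3)] card_cycles_on_merge[OF S h _ y(1) y_h(2)]
    by (simp add: q h_def)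
  have "b \<noteq> y" using y(2) b by blast
  then show "y \<in> orbit q b"
    using in_orbit_transpose_comp_iff[OF h] y_h(2) by (simp add: q h_def)
qed

text \<open>\<open>transpose a b \<circ> g\<close> has two cycles, one through \<open>a\<close> and one through \<open>b\<close>; joining \<open>y\<close> to
  the one that does not contain it gives back a single cycle.\<close>

lemma cyclic_perms_on_cut_and_glue:
  assumes S: "finite S" and g: "g \<in> cyclic_perms_on S"
    and ab: "a \<in> S" "b \<in> S" "a \<noteq> b" and y: "y \<in> S"
  shows "transpose a y \<circ> (transpose a b \<circ> g) \<in> cyclic_perms_on S \<or>
    transpose b y \<circ> (transpose a b \<circ> g) \<in> cyclic_perms_on S"
proof -
  have gS: "g permutes S" "card (cycles_on S g) = 1" and cyc: "cyclic_on g S"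
    using g cyclic_perms_on_iff_card[OF S] by (auto simp: cyclic_perms_on_def)
  have perm_g: "permutation g" using S g by (rule cyclic_perms_on_imp_permutation)
  have b: "b \<in> orbit g a" using cyc ab by (auto simp: cyclic_on_alldef)
  define h where "h = transpose a b \<circ> g"
  have h: "h permutes S" unfolding h_def using gS(1) ab(1,2) by (rule permutes_transpose_comp)
  have perm_h: "permutation h" using S h by (rule permutes_imp_permutation)
  have two: "card (cycles_on S h) = 2"
    using card_cycles_on_split[OF S perm_g ab(1,2) b ab(3)] gS(2) by (simp add: h_def)
  have joined: "transpose u y \<circ> h \<in> cyclic_perms_on S" if "u \<in> S" "y \<notin> orbit h u" for u
    using card_cycles_on_merge[OF S perm_h that(1) y that(2)] two
      permutes_transpose_comp[OF h that(1) y] cyclic_perms_on_iff_card[OF S] by simp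
  have "b \<notin> orbit h a" unfolding h_def using b ab(3) by (rule notin_orbit_transpose_comp)
  then have "y \<notin> orbit h a \<or> y \<notin> orbit h b" using orbit_disjoint[OF perm_h] by blast
  then show ?thesis using joined ab unfolding h_def by blast
qed

subsection \<open>The two top levels\<close>

definition free_count :: "'a set \<Rightarrow> 'a set \<Rightarrow> ('a \<Rightarrow> 'a) \<Rightarrow> ('a \<Rightarrow> 'a) \<Rightarrow> nat" where
  "free_count S E D g = card (free_cycles_on S E (D \<circ> g))"

definition max_free_count :: "'a set \<Rightarrow> 'a set \<Rightarrow> ('a \<Rightarrow> 'a) \<Rightarrow> nat" where
  "max_free_count S E D = Max (free_count S E D ` cyclic_perms_on S)"

definition level :: "'a set \<Rightarrow> 'a set \<Rightarrow> ('a \<Rightarrow> 'a) \<Rightarrow> nat \<Rightarrow> ('a \<Rightarrow> 'a) set" where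
  "level S E D k = {g \<in> cyclic_perms_on S. free_count S E D g + k = max_free_count S E D}"

definition planar :: "'a set \<Rightarrow> ('a \<Rightarrow> 'a) \<Rightarrow> ('a \<Rightarrow> 'a) \<Rightarrow> bool" where
  "planar S D g \<longleftrightarrow> card (cycles_on S D) + card (cycles_on S (D \<circ> g)) = card S + 1"

lemma finite_level [simp]: "finite S \<Longrightarrow> finite (level S E D k)"
  by (simp add: level_def)

lemma permutation_comp_cyclic_perm:
  "finite S \<Longrightarrow> D permutes S \<Longrightarrow> g \<in> cyclic_perms_on S \<Longrightarrow> permutation (D \<circ> g)"
  by (intro permutation_compose permutes_imp_permutation cyclic_perms_on_imp_permutation)

lemma card_cycles_on_comp_cyclic_le:
  assumes S: "finite S" and D: "D permutes S" and g: "g \<in> cyclic_perms_on S"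
  shows "card (cycles_on S D) + card (cycles_on S (D \<circ> g)) \<le> card S + 1"
  using card_cycles_on_comp_le[OF S D cyclic_perms_on_imp_permutation[OF S g]] g
    cyclic_perms_on_iff_card[OF S, of g] by simp

lemma planar_imp_orbits_meet_once:
  assumes S: "finite S" and D: "D permutes S" and g: "g \<in> cyclic_perms_on S" "planar S D g"
    and xy: "x \<in> S" "y \<in> orbit D x" "y \<in> orbit (D \<circ> g) x"
  shows "x = y"
proof (rule orbits_meet_once[OF S D _ _ xy])
  show "permutation g" using S g(1) by (rule cyclic_perms_on_imp_permutation)
  show "card (cycles_on S D) + card (cycles_on S (D \<circ> g)) = card S + card (cycles_on S g)"
    using g cyclic_perms_on_iff_card[OF S] by (simp add: planar_def)
qed

lemma free_count_le:
  assumes S: "finite S" and D: "D permutes S" and E: "E \<subseteq> S" "E \<noteq> {}"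
    and g: "g \<in> cyclic_perms_on S"
  shows "free_count S E D g + card (cycles_on S D) \<le> card S"
  using card_free_cycles_on_less[OF S permutation_comp_cyclic_perm[OF S D g] E]
    card_cycles_on_comp_cyclic_le[OF S D g] unfolding free_count_def by linarith

lemma free_count_eq_iff:
  assumes S: "finite S" and D: "D permutes S" and E: "E \<subseteq> S" "e \<in> E"
    and g: "g \<in> cyclic_perms_on S"
  shows "free_count S E D g + card (cycles_on S D) = card S
    \<longleftrightarrow> planar S D g \<and> E \<subseteq> orbit (D \<circ> g) e"
proof -
  have perm: "permutation (D \<circ> g)" using S D g by (rule permutation_comp_cyclic_perm)
  have "card (free_cycles_on S E (D \<circ> g)) < card (cycles_on S (D \<circ> g))"
    using S perm E by (intro card_free_cycles_on_less) auto
  moreover have "card (free_cycles_on S E (D \<circ> g)) + 1 = card (cycles_on S (D \<circ> g))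
      \<longleftrightarrow> E \<subseteq> orbit (D \<circ> g) e"
    using S perm E by (rule card_free_cycles_on_eq_iff)
  ultimately show ?thesis
    using card_cycles_on_comp_cyclic_le[OF S D g] unfolding free_count_def planar_def by linarith
qed

lemma max_free_count_eq:
  assumes S: "finite S" and D: "D permutes S" and E: "E \<subseteq> S" "E \<noteq> {}" "inj_on (orbit D) E"
  shows "max_free_count S E D + card (cycles_on S D) = card S"
proof -
  obtain e where e: "e \<in> E" using E(2) by blast
  obtain g where g: "g \<in> cyclic_perms_on S" "planar S D g" "E \<subseteq> orbit (D \<circ> g) e"
    using exists_genus_zero_cyclic_perm[OF S D E(1,3) e] by (auto simp: planar_def)
  then have eq: "free_count S E D g + card (cycles_on S D) = card S"
    using free_count_eq_iff[OF S D E(1) e g(1)] by simp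
  have "max_free_count S E D = free_count S E D g"
    unfolding max_free_count_def
  proof (rule Max_eqI)
    fix m assume "m \<in> free_count S E D ` cyclic_perms_on S"
    then show "m \<le> free_count S E D g" using free_count_le[OF S D E(1,2)] eq by fastforce
  qed (use g(1) S in auto)
  then show ?thesis using eq by simp
qed

lemma level_iff:
  assumes "finite S" "D permutes S" "E \<subseteq> S" "E \<noteq> {}" "inj_on (orbit D) E"
  shows "g \<in> level S E D k \<longleftrightarrow>
    g \<in> cyclic_perms_on S \<and> free_count S E D g + k + card (cycles_on S D) = card S"
  using max_free_count_eq[OF assms] by (auto simp: level_def)

lemma level_0_iff:
  assumes "finite S" "D permutes S" "E \<subseteq> S" "e \<in> E" "inj_on (orbit D) E"
  shows "g \<in> level S E D 0 \<longleftrightarrow> g \<in> cyclic_perms_on S \<and> planar S D g \<and> E \<subseteq> orbit (D \<circ> g) e"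
proof -
  have "E \<noteq> {}" using assms(4) by blast
  then show ?thesis
    using level_iff[OF assms(1-3) _ assms(5), of g 0] free_count_eq_iff[OF assms(1-4), of g] by auto
qed

definition cut_glue :: "('a \<Rightarrow> 'a) \<Rightarrow> 'a \<Rightarrow> 'a \<Rightarrow> 'a \<Rightarrow> ('a \<Rightarrow> 'a) \<Rightarrow> 'a \<Rightarrow> 'a" where
  "cut_glue D a b y g = transpose (inv D b) (inv D y) \<circ> (transpose (inv D a) (inv D b) \<circ> g)"

lemma comp_cut_glue:
  assumes "bij D"
  shows "D \<circ> cut_glue D a b y g = transpose b y \<circ> (transpose a b \<circ> (D \<circ> g))"
  using transpose_comp_eq[OF assms]
  by (simp add: cut_glue_def comp_assoc) (simp flip: comp_assoc)

lemma cut_glue_cancel: "cut_glue D a b y g = cut_glue D a b y h \<longleftrightarrow> g = h"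
  by (auto simp: cut_glue_def fun_eq_iff dest: transpose_eq_imp_eq)

lemma cut_glue_in_cyclic_perms_on:
  assumes S: "finite S" and D: "D permutes S" and g: "g \<in> cyclic_perms_on S"
    and ab: "a \<in> S" "b \<in> S" "a \<noteq> b" and y: "y \<in> S"
  shows "cut_glue D a b y g \<in> cyclic_perms_on S \<or> cut_glue D b a y g \<in> cyclic_perms_on S"
proof -
  have "inv D a \<noteq> inv D b" using ab(3) inj_eq[OF permutes_inj[OF permutes_inv[OF D]]] by simp
  moreover have "inv D u \<in> S" if "u \<in> S" for u
    using that permutes_in_image[OF permutes_inv[OF D]] by blast
  ultimately show ?thesis
    using cyclic_perms_on_cut_and_glue[OF S g, of "inv D a" "inv D b" "inv D y"] ab y
    by (auto simp: cut_glue_def transpose_commute)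
qed

lemma cut_glue_level_0:
  assumes S: "finite S" and D: "D permutes S" and E: "E \<subseteq> S" "inj_on (orbit D) E"
    and ab: "a \<in> E" "b \<in> E" "a \<noteq> b" and g: "g \<in> level S E D 0"
    and y: "y \<in> S" "y \<notin> orbit (D \<circ> g) a" and cyc: "cut_glue D a b y g \<in> cyclic_perms_on S"
  shows "cut_glue D a b y g \<in> level S E D 1" "planar S D (cut_glue D a b y g)"
    "y \<in> orbit (D \<circ> cut_glue D a b y g) b"
proof -
  have g_props: "g \<in> cyclic_perms_on S" "planar S D g" "E \<subseteq> orbit (D \<circ> g) a"
    using g level_0_iff[OF S D E(1) ab(1) E(2)] by auto
  have perm: "permutation (D \<circ> g)" using S D g_props(1) by (rule permutation_comp_cyclic_perm)
  note comp = comp_cut_glue[OF permutes_bij[OF D]]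
  note moved = cycles_on_cut_and_glue[OF S perm ab E(1) g_props(3) y comp]
  show "cut_glue D a b y g \<in> level S E D 1"
    using moved(1) g cyc by (auto simp: level_def free_count_def)
  show "planar S D (cut_glue D a b y g)" using moved(2) g_props(2) by (simp add: planar_def)
  show "y \<in> orbit (D \<circ> cut_glue D a b y g) b" by (rule moved(3))
qed

lemma cut_glue_eq_imp_eq:
  assumes S: "finite S" and D: "D permutes S" and E: "E \<subseteq> S" "inj_on (orbit D) E"
    and ab: "a \<in> E" "b \<in> E" "a \<noteq> b" and C: "C \<in> cycles_on S D"
    and g: "g \<in> level S E D 0" "y \<in> C" "y \<notin> orbit (D \<circ> g) a"
    and h: "h \<in> level S E D 0" "z \<in> C" "z \<notin> orbit (D \<circ> h) a"
    and eq: "cut_glue D a b y g = cut_glue D a b z h"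
    and cyc: "cut_glue D a b y g \<in> cyclic_perms_on S"
  shows "g = h"
proof -
  define k where "k = cut_glue D a b y g"
  have k: "k = cut_glue D a b y g" "k = cut_glue D a b z h" "k \<in> cyclic_perms_on S"
    using eq cyc by (auto simp: k_def)
  have in_S: "y \<in> S" "z \<in> S"
    using g(2) h(2) C permutes_orbit_subset[OF D] by (auto simp: cycles_on_def)
  have y_k: "y \<in> orbit (D \<circ> k) b" and planar: "planar S D k"
    using cut_glue_level_0(2,3)[OF S D E ab g(1) in_S(1) g(3)] k by auto
  have z_k: "z \<in> orbit (D \<circ> k) b"
    using cut_glue_level_0(3)[OF S D E ab h(1) in_S(2) h(3)] k by auto
  have perm: "permutation D" "permutation (D \<circ> k)"
    using permutes_imp_permutation[OF S D] permutation_comp_cyclic_perm[OF S D k(3)] by auto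
  have "z \<in> orbit D y" using g(2) h(2) orbit_eq_cycle_iff[OF perm(1) C, of y] by blast
  moreover have "z \<in> orbit (D \<circ> k) y" using y_k z_k orbit_eq_iff[OF perm(2), of y b] by simp
  ultimately have "y = z" by (rule planar_imp_orbits_meet_once[OF S D k(3) planar in_S(1)])
  then show "g = h" using eq cut_glue_cancel by metis
qed

definition movable ::
    "'a set \<Rightarrow> 'a set \<Rightarrow> ('a \<Rightarrow> 'a) \<Rightarrow> 'a set \<Rightarrow> 'a \<Rightarrow> 'a \<Rightarrow> ('a \<Rightarrow> 'a) set" where
  "movable S E D C a b = {g \<in> level S E D 0.
    \<exists>y \<in> C. y \<notin> orbit (D \<circ> g) a \<and> cut_glue D a b y g \<in> cyclic_perms_on S}"

lemma card_movable_le: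
  assumes S: "finite S" and D: "D permutes S" and E: "E \<subseteq> S" "inj_on (orbit D) E"
    and ab: "a \<in> E" "b \<in> E" "a \<noteq> b" and C: "C \<in> cycles_on S D"
  shows "card (movable S E D C a b) \<le> card (level S E D 1)"
proof (rule card_le_if_inj_on_rel)
  let ?moves = "\<lambda>g h. \<exists>y \<in> C. y \<notin> orbit (D \<circ> g) a \<and> h = cut_glue D a b y g"
  have C_subset: "C \<subseteq> S" using C permutes_orbit_subset[OF D] by (auto simp: cycles_on_def)
  show "\<exists>h. h \<in> level S E D 1 \<and> ?moves g h" if "g \<in> movable S E D C a b" for g
    using that cut_glue_level_0(1)[OF S D E ab, of g] C_subset by (fastforce simp: movable_def)
  show "g = h"
    if "g \<in> movable S E D C a b" "h \<in> movable S E D C a b" "k \<in> level S E D 1"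
      "?moves g k" "?moves h k" for g h k
  proof -
    have "g \<in> level S E D 0" "h \<in> level S E D 0" "k \<in> cyclic_perms_on S"
      using that(1-3) by (simp_all add: movable_def level_def)
    then show ?thesis using that(4,5) cut_glue_eq_imp_eq[OF S D E ab C, of g _ h] by blast
  qed
qed (simp add: S)

lemma level_0_subset_movable:
  assumes S: "finite S" and D: "D permutes S" and E: "E \<subseteq> S" "inj_on (orbit D) E"
    and ab: "a \<in> E" "b \<in> E" "a \<noteq> b" and z: "z \<in> S" "D z \<noteq> z"
  shows "level S E D 0 \<subseteq> movable S E D (orbit D z) a b \<union> movable S E D (orbit D z) b a"
proof
  fix g assume g: "g \<in> level S E D 0"
  have g_props: "g \<in> cyclic_perms_on S" "planar S D g" "E \<subseteq> orbit (D \<circ> g) a"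
    using g level_0_iff[OF S D E(1) ab(1) E(2)] by auto
  have perm: "permutation D" "permutation (D \<circ> g)"
    using permutes_imp_permutation[OF S D] permutation_comp_cyclic_perm[OF S D g_props(1)] by auto
  have same_orbit: "orbit (D \<circ> g) b = orbit (D \<circ> g) a"
    using g_props(3) ab(2) orbit_eq_iff[OF perm(2), of b a] by blast
  have "D z \<notin> orbit (D \<circ> g) z"
    using planar_imp_orbits_meet_once[OF S D g_props(1,2) z(1) orbit.base] z(2) by metis
  then have "z \<notin> orbit (D \<circ> g) a \<or> D z \<notin> orbit (D \<circ> g) a"
    using orbit_eq_iff[OF perm(2), of z a] by metis
  then obtain y where y: "y \<in> orbit D z" "y \<notin> orbit (D \<circ> g) a"
    using permutation_self_in_orbit[OF perm(1), of z] orbit.base[of D z] by blast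
  have "y \<in> S" using permutes_orbit_subset[OF D z(1)] y(1) by blast
  then have "cut_glue D a b y g \<in> cyclic_perms_on S \<or> cut_glue D b a y g \<in> cyclic_perms_on S"
    using cut_glue_in_cyclic_perms_on[OF S D g_props(1) _ _ ab(3)] ab E(1) by blast
  then show "g \<in> movable S E D (orbit D z) a b \<union> movable S E D (orbit D z) b a"
    using g y same_orbit by (auto simp: movable_def)
qed

lemma card_level_0_le_if_separated:
  assumes S: "finite S" and D: "D permutes S" "D \<noteq> id"
    and E: "E \<subseteq> S" "card E > 1" "inj_on (orbit D) E"
  shows "card (level S E D 0) \<le> 2 * card (level S E D 1)"
proof -
  have "\<not> (\<forall>a \<in> E. \<forall>b \<in> E. a = b)"
    using E(2) card_le_Suc0_iff_eq[OF finite_subset[OF E(1) S]] by simp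
  then obtain a b where ab: "a \<in> E" "b \<in> E" "a \<noteq> b" by blast
  obtain z where "D z \<noteq> z" using D(2) by (auto simp: fun_eq_iff)
  moreover from this have "z \<in> S" using permutes_not_in[OF D(1)] by blast
  ultimately have z: "z \<in> S" "D z \<noteq> z" "orbit D z \<in> cycles_on S D" by (auto simp: cycles_on_def)
  let ?movable = "movable S E D (orbit D z)"
  have "card (level S E D 0) \<le> card (?movable a b \<union> ?movable b a)"
    using level_0_subset_movable[OF S D(1) E(1,3) ab z(1,2)] S
    by (intro card_mono) (auto simp: movable_def)
  also have "\<dots> \<le> card (?movable a b) + card (?movable b a)" by (rule card_Un_le)
  also have "\<dots> \<le> card (level S E D 1) + card (level S E D 1)"
    using S D(1) E(1,3) ab z(3) by (intro add_mono card_movable_le) auto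
  finally show ?thesis by simp
qed

subsection \<open>Reduction to separated labels\<close>

lemma exists_separating_representative:
  assumes S: "finite S" and D: "D permutes S" and E: "E \<subseteq> S"
  obtains \<pi> where "\<pi> permutes E" "inj_on (orbit (\<pi> \<circ> D)) E"
proof -
  let ?m = "\<lambda>\<pi>. card (cycles_on S (\<pi> \<circ> D))"
  have "\<exists>\<pi>. \<pi> permutes E \<and> (\<forall>\<rho>. \<rho> permutes E \<longrightarrow> ?m \<rho> \<le> ?m \<pi>)"
    using card_cycles_on_le[OF S]
    by (intro ex_has_greatest_nat[where k = id and b = "Suc (card S)"])
      (auto simp: permutes_id le_imp_less_Suc)
  then obtain \<pi> where \<pi>: "\<pi> permutes E" and max: "\<And>\<rho>. \<rho> permutes E \<Longrightarrow> ?m \<rho> \<le> ?m \<pi>" by blast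
  have perm: "permutation (\<pi> \<circ> D)"
    using permutes_imp_permutation[OF finite_subset[OF E S] \<pi>] permutes_imp_permutation[OF S D]
    by (rule permutation_compose)
  have "inj_on (orbit (\<pi> \<circ> D)) E"
  proof (rule inj_onI, rule ccontr)
    fix a b assume ab: "a \<in> E" "b \<in> E" "orbit (\<pi> \<circ> D) a = orbit (\<pi> \<circ> D) b" "a \<noteq> b"
    then have "b \<in> orbit (\<pi> \<circ> D) a" using permutation_self_in_orbit[OF perm, of b] by simp
    then have "card (cycles_on S (transpose a b \<circ> (\<pi> \<circ> D))) = ?m \<pi> + 1"
      using ab E by (intro card_cycles_on_split[OF S perm]) auto
    then show False using max[OF permutes_transpose_comp[OF \<pi> ab(1,2)]] by (simp add: comp_assoc)
  qed
  with \<pi> show thesis by (rule that)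
qed

lemma level_permutes_comp:
  assumes S: "finite S" and D: "D permutes S" and E: "E \<subseteq> S" and \<pi>: "\<pi> permutes E"
  shows "level S E (\<pi> \<circ> D) k = level S E D k"
proof -
  have perm: "permutation \<pi>" using finite_subset[OF E S] \<pi> by (rule permutes_imp_permutation)
  have count: "free_count S E (\<pi> \<circ> D) g = free_count S E D g" if "g \<in> cyclic_perms_on S" for g
    using free_cycles_on_permutes_comp[OF permutation_comp_cyclic_perm[OF S D that] \<pi> perm, of S]
    by (simp add: free_count_def comp_assoc)
  then have "max_free_count S E (\<pi> \<circ> D) = max_free_count S E D"
    unfolding max_free_count_def by (simp cong: image_cong)
  with count show ?thesis by (auto simp: level_def)
qed

theorem card_level_0_le:
  assumes S: "finite S" and D: "D permutes S" "\<not> D permutes E" and E: "E \<subseteq> S" "card E > 1"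
  shows "card (level S E D 0) \<le> 2 * card (level S E D 1)"
proof -
  obtain \<pi> where \<pi>: "\<pi> permutes E" "inj_on (orbit (\<pi> \<circ> D)) E"
    using exists_separating_representative[OF S D(1) E(1)] .
  have "\<pi> \<circ> D \<noteq> id"
  proof
    assume "\<pi> \<circ> D = id"
    then have "D = inv \<pi>" using permutes_inv_o(2)[OF \<pi>(1)] by (metis comp_assoc comp_id id_comp)
    then show False using D(2) permutes_inv[OF \<pi>(1)] by simp
  qed
  moreover have "\<pi> \<circ> D permutes S"
    using permutes_subset[OF \<pi>(1) E(1)] D(1) by (intro permutes_compose)
  ultimately have "card (level S E (\<pi> \<circ> D) 0) \<le> 2 * card (level S E (\<pi> \<circ> D) 1)"
    using S E \<pi>(2) by (intro card_level_0_le_if_separated)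
  then show ?thesis by (simp only: level_permutes_comp[OF S D(1) E(1) \<pi>(1)])
qed

lemma admissible_not_permutes:
  assumes "admissible n D E"
  shows "\<not> D permutes E"
proof
  assume DE: "D permutes E"
  have free: "card C = 1" if "C \<in> perm_cycles n D" "C \<inter> E = {}" for C
  proof -
    obtain z where z: "C = orbit D z" using \<open>C \<in> perm_cycles n D\<close> by (auto simp: perm_cycles_def)
    then have "D z \<notin> E" using \<open>C \<inter> E = {}\<close> orbit.base[of D z] by blast
    then have "orbit D z = {z}"
      using permutes_in_image[OF DE] permutes_not_in[OF DE] by (simp add: orbit_eq_singleton_iff)
    then show ?thesis using z by simp
  qed
  have meets: "C \<subseteq> E" if "C \<in> perm_cycles n D" "C \<inter> E \<noteq> {}" for C
  proof -
    obtain z where z: "C = orbit D z" using \<open>C \<in> perm_cycles n D\<close> by (auto simp: perm_cycles_def)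
    obtain u where u: "u \<in> C" "u \<in> E" using \<open>C \<inter> E \<noteq> {}\<close> by blast
    have "permutation D"
      using assms by (auto simp: admissible_def intro: permutes_imp_permutation)
    then have "C = orbit D u" using u(1) z orbit_eq_iff by metis
    then show ?thesis using permutes_orbit_subset[OF DE u(2)] by simp
  qed
  show False using assms free meets unfolding admissible_def by fastforce
qed

lemma
  shows maximizers_eq_level_0:
      "{g \<in> cyclic_perms n. label_free_count n E (D \<circ> g) = theta n D E} = level {1..n} E D 0"
    and next_to_maximizers_eq_level_1:
      "{g \<in> cyclic_perms n. int (label_free_count n E (D \<circ> g)) = int (theta n D E) - 1}
        = level {1..n} E D 1"
proof -
  have cyc: "cyclic_perms n = cyclic_perms_on {1..n}"
    by (simp add: cyclic_perms_def cyclic_perms_on_def)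
  have count: "label_free_count n E (D \<circ> g) = free_count {1..n} E D g" for g
    unfolding label_free_count_def free_count_def free_cycles_on_def perm_cycles_def cycles_on_def
    by (rule refl)
  show "{g \<in> cyclic_perms n. label_free_count n E (D \<circ> g) = theta n D E} = level {1..n} E D 0"
    and "{g \<in> cyclic_perms n. int (label_free_count n E (D \<circ> g)) = int (theta n D E) - 1}
      = level {1..n} E D 1"
    unfolding theta_def count cyc level_def max_free_count_def by auto
qed

subsection \<open>The case of equality\<close>

lemma inj_on_cycle_of_list_Cons:
  "inj_on (\<lambda>xs. cycle_of_list (a # xs)) {xs. distinct (a # xs) \<and> length xs = n}"
proof (rule inj_onI)
  fix xs ys
  assume xs: "xs \<in> {xs. distinct (a # xs) \<and> length xs = n}"
    and ys: "ys \<in> {xs. distinct (a # xs) \<and> length xs = n}"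
    and eq: "cycle_of_list (a # xs) = cycle_of_list (a # ys)"
  have "a # xs = a # ys"
  proof (rule nth_equalityI)
    show "(a # xs) ! i = (a # ys) ! i" if "i < length (a # xs)" for i
      using funpow_cycle_of_list_hd[of "a # xs" i] funpow_cycle_of_list_hd[of "a # ys" i]
        that xs ys eq by simp
  qed (use xs ys in simp)
  then show "xs = ys" by simp
qed

lemma cyclic_perms_on_cycle_of_listE:
  assumes "finite S" "g \<in> cyclic_perms_on S" "a \<in> S"
  obtains xs where "distinct (a # xs)" "set (a # xs) = S" "g = cycle_of_list (a # xs)"
proof -
  have g: "g permutes S" "orbit g a = S"
    using assms(2,3) by (auto simp: cyclic_perms_on_def cyclic_on_alldef)
  have perm: "permutation g" using assms(1,2) by (rule cyclic_perms_on_imp_permutation)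
  obtain xs where xs: "support g a = a # xs"
    using least_power_of_permutation(2)[OF perm, of a] by (simp add: upt_rec)
  have set_xs: "set (a # xs) = S"
    using support_set[OF perm, of a] g(2) orbit_altdef_permutation[OF perm, of a]
    unfolding xs by auto
  have "g u = cycle_of_list (a # xs) u" for u
    using cycle_restrict[OF perm, of u a] id_outside_supp[of u "a # xs"]
      permutes_not_in[OF g(1)] set_xs
    unfolding xs by (cases "u \<in> S") auto
  moreover have "distinct (a # xs)" using cycle_of_permutation[OF perm, of a] unfolding xs .
  ultimately show thesis using set_xs that by blast
qed

lemma bij_betw_cycle_of_list_cyclic_perms_on:
  assumes S: "finite S" and a: "a \<in> S"
  shows "bij_betw (\<lambda>xs. cycle_of_list (a # xs)) (permutations_of_set (S - {a})) (cyclic_perms_on S)"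
proof (rule bij_betw_imageI)
  have words: "xs \<in> permutations_of_set (S - {a}) \<longleftrightarrow> distinct (a # xs) \<and> set (a # xs) = S" for xs
    using a by (auto simp: permutations_of_set_def)
  show "inj_on (\<lambda>xs. cycle_of_list (a # xs)) (permutations_of_set (S - {a}))"
    using words length_finite_permutations_of_set[of _ "S - {a}"]
    by (intro inj_on_subset[OF inj_on_cycle_of_list_Cons[of a "card (S - {a})"]]) auto
  show "(\<lambda>xs. cycle_of_list (a # xs)) ` permutations_of_set (S - {a}) = cyclic_perms_on S"
  proof (intro equalityI subsetI)
    fix g assume "g \<in> (\<lambda>xs. cycle_of_list (a # xs)) ` permutations_of_set (S - {a})"
    then obtain xs where "xs \<in> permutations_of_set (S - {a})" "g = cycle_of_list (a # xs)" by blast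
    then show "g \<in> cyclic_perms_on S"
      using words cycle_of_list_in_cyclic_perms_on[of "a # xs"] by simp
  next
    fix g assume "g \<in> cyclic_perms_on S"
    then obtain xs where "distinct (a # xs)" "set (a # xs) = S" "g = cycle_of_list (a # xs)"
      using cyclic_perms_on_cycle_of_listE[OF S _ a] by blast
    then show "g \<in> (\<lambda>xs. cycle_of_list (a # xs)) ` permutations_of_set (S - {a})"
      using words by blast
  qed
qed

lemma cyclic_perms_on_apply_neq:
  assumes "g \<in> cyclic_perms_on S" "z \<in> S" "card S \<noteq> 1"
  shows "g z \<noteq> z"
  using assms eq_on_cyclic_on_iff1[of g S z] by (auto simp: cyclic_perms_on_def)

lemma transpose_3_4_permutes: "transpose 3 4 permutes {1..4::nat}"
  by (rule permutes_swap_id) auto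

lemma card_cycles_on_four: "card (cycles_on {1..4} (transpose 3 (4::nat))) = 3"
proof -
  have "orbit id 3 = {3::nat}" by (simp add: orbit_eq_singleton_iff)
  then show ?thesis
    using card_cycles_on_merge[of "{1..4}" id 3 "4::nat"] card_cycles_on_id[of "{1..4::nat}"]
    by simp
qed

lemma level_four:
  "level {1..4} {1, 2} (transpose 3 (4::nat)) k = {g \<in> cyclic_perms_on {1..4}.
    card (free_cycles_on {1..4} {1, 2} (transpose 3 4 \<circ> g)) + k = 1}"
proof -
  have "orbit (transpose 3 4) z = {z}" if "z \<in> {1, 2}" for z :: nat
    using that by (auto simp: orbit_eq_singleton_iff)
  then have "inj_on (orbit (transpose 3 4)) {1, 2::nat}" by (auto simp: inj_on_def)
  then have "g \<in> level {1..4} {1, 2} (transpose 3 (4::nat)) k \<longleftrightarrow>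
      g \<in> cyclic_perms_on {1..4} \<and>
      free_count {1..4} {1, 2} (transpose 3 4) g + k +
        card (cycles_on {1..4} (transpose 3 (4::nat))) = card {1..4::nat}" for g
    by (intro level_iff transpose_3_4_permutes) auto
  then show ?thesis unfolding card_cycles_on_four free_count_def by auto
qed

lemma transpose_comp_cyclic_perm_four_cases:
  assumes g: "g \<in> cyclic_perms_on {1..4}" and z: "z \<in> {3, 4::nat}"
  shows "(transpose 3 4 \<circ> g) z = z \<or> (transpose 3 4 \<circ> g) z \<in> {1, 2}"
proof -
  have "g z \<in> {1..4}" "g z \<noteq> z"
    using g z permutes_in_image[of g "{1..4}" z] cyclic_perms_on_apply_neq[OF g, of z]
    by (auto simp: cyclic_perms_on_def)
  then have "g z = 1 \<or> g z = 2 \<or> transpose 3 4 (g z) = z" using z by (auto simp: transpose_eq_iff)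
  then show ?thesis by auto
qed

lemma free_cycles_on_four_empty_iff:
  assumes g: "g \<in> cyclic_perms_on {1..4::nat}"
  shows "free_cycles_on {1..4} {1, 2} (transpose 3 4 \<circ> g) = {} \<longleftrightarrow> g 3 \<noteq> 4 \<and> g 4 \<noteq> 3"
proof -
  let ?s = "transpose 3 4 \<circ> g"
  have perm: "permutation ?s"
    using g by (intro permutation_compose permutation_swap_id cyclic_perms_on_imp_permutation) auto
  have "free_cycles_on {1..4} {1, 2} ?s = {} \<longleftrightarrow> (\<forall>z \<in> {3, 4}. ?s z \<noteq> z)"
  proof (intro iffI ballI)
    fix z :: nat
    assume empty: "free_cycles_on {1..4} {1, 2} ?s = {}" and z: "z \<in> {3, 4}"
    show "?s z \<noteq> z"
    proof
      assume "?s z = z"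
      then have "orbit ?s z = {z}" by (simp add: orbit_eq_singleton_iff)
      then have "{z} \<in> free_cycles_on {1..4} {1, 2} ?s"
        using z by (auto simp: free_cycles_on_def cycles_on_def intro!: image_eqI[of _ _ z])
      then show False using empty by simp
    qed
  next
    assume no_fixpoint: "\<forall>z \<in> {3, 4}. ?s z \<noteq> z"
    have "orbit ?s z \<inter> {1, 2} \<noteq> {}" if "z \<in> {1..4}" for z
    proof (cases "z \<in> {3, 4}")
      case True
      then have "?s z \<in> {1, 2}"
        using no_fixpoint transpose_comp_cyclic_perm_four_cases[OF g True] by blast
      then show ?thesis using orbit.base[of ?s z] by blast
    next
      case False
      then have "z \<in> {1, 2}" using that by auto
      then show ?thesis using permutation_self_in_orbit[OF perm, of z] by blast
    qed
    then show "free_cycles_on {1..4} {1, 2} ?s = {}"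
      unfolding free_cycles_on_def cycles_on_def by blast
  qed
  also have "\<dots> \<longleftrightarrow> g 3 \<noteq> 4 \<and> g 4 \<noteq> 3" by (auto simp: transpose_eq_iff)
  finally show ?thesis .
qed

lemma card_free_cycles_on_four:
  assumes g: "g \<in> cyclic_perms_on {1..4::nat}"
  shows "card (free_cycles_on {1..4} {1, 2} (transpose 3 4 \<circ> g))
    = (if g 3 \<noteq> 4 \<and> g 4 \<noteq> 3 then 0 else 1)"
proof -
  have "free_count {1..4} {1, 2} (transpose 3 4) g + card (cycles_on {1..4} (transpose 3 (4::nat)))
      \<le> card {1..4::nat}"
    using g by (intro free_count_le transpose_3_4_permutes) auto
  then have "card (free_cycles_on {1..4} {1, 2} (transpose 3 4 \<circ> g)) \<le> 1"
    unfolding card_cycles_on_four free_count_def by simp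
  moreover have "card (free_cycles_on {1..4} {1, 2} (transpose 3 4 \<circ> g)) = 0
      \<longleftrightarrow> g 3 \<noteq> 4 \<and> g 4 \<noteq> 3"
    by (simp only: card_0_eq[OF finite_free_cycles_on[OF finite_atLeastAtMost]]
        free_cycles_on_four_empty_iff[OF g])
  ultimately show ?thesis by presburger
qed

lemma card_cyclic_perms_on_four_Collect:
  "card {g \<in> cyclic_perms_on {1..4::nat}. Q g} = card {xs \<in>
    {[2, 3, 4], [2, 4, 3], [3, 2, 4], [3, 4, 2], [4, 2, 3], [4, 3, 2]}. Q (cycle_of_list (1 # xs))}"
proof -
  have "{1..4} - {1} = {2, 3, 4::nat}" by auto
  moreover have "permutations_of_set {2, 3, 4::nat}
      = {[2, 3, 4], [2, 4, 3], [3, 2, 4], [3, 4, 2], [4, 2, 3], [4, 3, 2]}"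
    by (subst permutations_of_set_nonempty)
      (auto simp: permutations_of_set_doubleton insert_Diff_if)
  ultimately have "bij_betw (\<lambda>xs. cycle_of_list (1 # xs))
      {[2, 3, 4], [2, 4, 3], [3, 2, 4], [3, 4, 2], [4, 2, 3], [4, 3, 2]}
      (cyclic_perms_on {1..4::nat})"
    using bij_betw_cycle_of_list_cyclic_perms_on[of "{1..4}" "1::nat"] by simp
  from bij_betw_same_card[OF bij_betw_Collect[OF this refl]] show ?thesis by (rule sym)
qed

lemma card_levels_four:
  shows "card (level {1..4} {1, 2} (transpose 3 (4::nat)) 0) = 4"
    and "card (level {1..4} {1, 2} (transpose 3 (4::nat)) 1) = 2"
proof -
  have "level {1..4} {1, 2} (transpose 3 (4::nat)) 0
      = {g \<in> cyclic_perms_on {1..4}. g 3 = 4 \<or> g 4 = 3}"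
    unfolding level_four
    by (intro Collect_cong conj_cong refl) (simp add: card_free_cycles_on_four del: One_nat_def)
  also have "card \<dots> = card {[2, 3, 4], [2, 4, 3], [3, 4, 2], [4, 3, 2::nat]}"
    unfolding card_cyclic_perms_on_four_Collect by (rule arg_cong[of _ _ card]) auto
  finally show "card (level {1..4} {1, 2} (transpose 3 (4::nat)) 0) = 4"
    by simp
  have "level {1..4} {1, 2} (transpose 3 (4::nat)) 1
      = {g \<in> cyclic_perms_on {1..4}. g 3 \<noteq> 4 \<and> g 4 \<noteq> 3}"
    unfolding level_four
    by (intro Collect_cong conj_cong refl) (simp add: card_free_cycles_on_four del: One_nat_def)
  also have "card \<dots> = card {[3, 2, 4], [4, 2, 3::nat]}"
    unfolding card_cyclic_perms_on_four_Collect by (rule arg_cong[of _ _ card]) auto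
  finally show "card (level {1..4} {1, 2} (transpose 3 (4::nat)) 1) = 2"
    by simp
qed

lemma admissible_four: "admissible 4 (transpose 3 4) {1, 2}"
proof -
  have "orbit (transpose 3 4) 3 = {3, 4::nat}"
  proof
    show "orbit (transpose 3 4) 3 \<subseteq> {3, 4::nat}" by (rule orbit_subsetI) auto
    show "{3, 4::nat} \<subseteq> orbit (transpose 3 4) 3"
      using orbit.base[of "transpose 3 4" "3::nat"]
        permutation_self_in_orbit[OF permutation_swap_id, of 3 3 "4::nat"] by simp
  qed
  then have "{3, 4} \<in> perm_cycles 4 (transpose 3 4)"
    and "card {3, 4::nat} > 1" "{3, 4::nat} \<inter> {1, 2} = {}"
    by (auto simp: perm_cycles_def intro!: image_eqI[of _ _ "3::nat"])
  then show ?thesis using transpose_3_4_permutes unfolding admissible_def by fastforce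
qed

theorem theorem1:
  shows "(\<forall>n D E. admissible n D E \<longrightarrow>
            real (card {g \<in> cyclic_perms n.
                    int (label_free_count n E (D \<circ> g)) = int (theta n D E) - 1})
            \<ge> 1 / 2 * real (card {g \<in> cyclic_perms n.
                    label_free_count n E (D \<circ> g) = theta n D E})) \<and>
         (\<exists>n D E. admissible n D E \<and>
            real (card {g \<in> cyclic_perms n.
                    int (label_free_count n E (D \<circ> g)) = int (theta n D E) - 1})
            = 1 / 2 * real (card {g \<in> cyclic_perms n.
                    label_free_count n E (D \<circ> g) = theta n D E}))"
    (is "(\<forall>n D E. _ \<longrightarrow> real (?next n D E) \<ge> 1 / 2 * real (?max n D E)) \<and> _")
proof (intro conjI allI impI)
  fix n D E assume adm: "admissible n D E"
  then have "card (level {1..n} E D 0) \<le> 2 * card (level {1..n} E D 1)"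
    using admissible_not_permutes[OF adm] by (intro card_level_0_le) (simp_all add: admissible_def)
  then show "real (?next n D E) \<ge> 1 / 2 * real (?max n D E)"
    unfolding maximizers_eq_level_0 next_to_maximizers_eq_level_1 by linarith
next
  have "real (?next 4 (transpose 3 4) {1, 2}) = 1 / 2 * real (?max 4 (transpose 3 4) {1, 2})"
    unfolding maximizers_eq_level_0 next_to_maximizers_eq_level_1 card_levels_four by simp
  with admissible_four
  show "\<exists>n D E. admissible n D E \<and> real (?next n D E) = 1 / 2 * real (?max n D E)" by blast
qed

end
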